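(* Let $\Gamma$ be a group with finite symmetric generating set $S=S^{-1}$ and let $H=\{h\in\Gamma\mid hSh^{-1}=S\}$. Let $c_{x'}$ be a harmonic cocycle for $(\Gamma,S)$, with associated functional $x'\colon\mathrm{I}[\Gamma]\to\mathbb{R}$ and associated seminorm $\|\cdot\|_{x'}$ on $\mathrm{I}[\Gamma]$. Then for any $h\in H$, right multiplication by $h$ induces on $\mathrm{I}[\Gamma]/\{\|\cdot\|_{x'}=0\}$ a translation by $h-\mathbf{1}$, in the sense that for every $\gamma\in\Gamma$ the elements $\gamma h-\gamma$ and $h-\mathbf{1}$ of $\mathrm{I}[\Gamma]$ have the same class in $\mathrm{I}[\Gamma]/\{\|\cdot\|_{x'}=0\}$. If $h\in H$ has finite order, then $\|\mathbf{1}-\gamma h\|_{x'}=\|\mathbf{1}-\gamma\|_{x'}$ for all $\gamma\in\Gamma$; in particular $\|\mathbf{1}-h\|_{x'}=0$.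
   Context: $\mathbf{1}$ denotes the neutral element of $\Gamma$, and $\mathrm{I}[\Gamma]=\{\sum_i\lambda_i\gamma_i\mid\gamma_i\in\Gamma,\ \lambda_i\in\mathbb{R},\ \sum_i\lambda_i=0\}\subset\mathbb{R}[\Gamma]$ is the augmentation ideal. $\Phi\colon\mathrm{I}[\Gamma]\otimes\mathrm{I}[\Gamma]\to\mathrm{I}[\Gamma]$ is the linear map obtained by restricting $\gamma_1\otimes\gamma_2\mapsto\gamma_1^{-1}\gamma_2$. For a linear functional $x'\colon\mathrm{I}[\Gamma]\to\mathbb{R}$ such that $\langle\cdot,\cdot\rangle_{x'}:=x'\circ\Phi$ is a (symmetric) positive semidefinite bilinear form on $\mathrm{I}[\Gamma]$ (this form is automatically invariant under left multiplication by $\Gamma$), let $\|\cdot\|_{x'}$ be the associated seminorm, let $\mathcal{H}_{x'}$ be the Hilbert space completion of $\mathrm{I}[\Gamma]/\{\|\cdot\|_{x'}=0\}$ with the orthogonal $\Gamma$-action induced by left multiplication, and let $c_{x'}\colon\Gamma\to\mathcal{H}_{x'}$ be the 1-cocycle sending $\gamma$ to the class of $\mathbf{1}-\gamma$. The cocycle $c_{x'}$ is harmonic for $(\Gamma,S)$ if $\sum_{s\in S}c_{x'}(s)=0$, equivalently $x'(\Delta^2)=\|\Delta\|_{x'}^2=0$ where $\Delta=|S|\cdot\mathbf{1}-\sum_{s\in S}s$. *)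

theory Defs
  imports Complex_Main "HOL-Library.Poly_Mapping" "HOL-Algebra.Generated_Groups"
    "HOL-Algebra.FiniteProduct"
begin

text \<open>
  The group ring \<open>\<real>[G]\<close> consists of the finitely supported functions \<open>'a \<Rightarrow>\<^sub>0 real\<close> whose support
  lies in \<open>carrier G\<close>; a group element \<open>g\<close> is identified with \<open>\<delta> g\<close>.
\<close>

abbreviation group_elem :: "'a \<Rightarrow> ('a \<Rightarrow>\<^sub>0 real)" (\<open>\<delta>\<close>) where
  "\<delta> g \<equiv> Poly_Mapping.single g 1"

abbreviation scale :: "real \<Rightarrow> ('a \<Rightarrow>\<^sub>0 real) \<Rightarrow> ('a \<Rightarrow>\<^sub>0 real)" (infixr \<open>*\<^sub>0\<close> 75) where
  "r *\<^sub>0 a \<equiv> Poly_Mapping.map ((*) r) a"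

definition aug_ideal :: "('a, 'b) monoid_scheme \<Rightarrow> ('a \<Rightarrow>\<^sub>0 real) set" where
  "aug_ideal G = {a. Poly_Mapping.keys a \<subseteq> carrier G \<and>
                     (\<Sum>g\<in>Poly_Mapping.keys a. Poly_Mapping.lookup a g) = 0}"

text \<open>
  The linear map \<open>\<Phi>\<close> on the tensor square is given as a bilinear map of two arguments: it is the
  bilinear extension of \<open>(g, h) \<mapsto> g\<^sup>-\<^sup>1 h\<close>, and is only used on the augmentation ideal.
\<close>

definition Phi :: "('a, 'b) monoid_scheme \<Rightarrow> ('a \<Rightarrow>\<^sub>0 real) \<Rightarrow> ('a \<Rightarrow>\<^sub>0 real) \<Rightarrow> ('a \<Rightarrow>\<^sub>0 real)" where
  "Phi G a b = (\<Sum>g\<in>Poly_Mapping.keys a. \<Sum>h\<in>Poly_Mapping.keys b.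
      (Poly_Mapping.lookup a g * Poly_Mapping.lookup b h) *\<^sub>0 \<delta> (inv\<^bsub>G\<^esub> g \<otimes>\<^bsub>G\<^esub> h))"

text \<open>Functionals on the augmentation ideal are total functions; their values elsewhere are ignored.\<close>

definition aug_functional :: "('a, 'b) monoid_scheme \<Rightarrow> (('a \<Rightarrow>\<^sub>0 real) \<Rightarrow> real) \<Rightarrow> bool" where
  "aug_functional G x \<longleftrightarrow>
     (\<forall>a\<in>aug_ideal G. \<forall>b\<in>aug_ideal G. x (a + b) = x a + x b) \<and>
     (\<forall>r. \<forall>a\<in>aug_ideal G. x (r *\<^sub>0 a) = r * x a)"

definition form :: "('a, 'b) monoid_scheme \<Rightarrow> (('a \<Rightarrow>\<^sub>0 real) \<Rightarrow> real) \<Rightarrow>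
    ('a \<Rightarrow>\<^sub>0 real) \<Rightarrow> ('a \<Rightarrow>\<^sub>0 real) \<Rightarrow> real" where
  "form G x a b = x (Phi G a b)"

definition psd_functional :: "('a, 'b) monoid_scheme \<Rightarrow> (('a \<Rightarrow>\<^sub>0 real) \<Rightarrow> real) \<Rightarrow> bool" where
  "psd_functional G x \<longleftrightarrow> aug_functional G x \<and>
     (\<forall>a\<in>aug_ideal G. \<forall>b\<in>aug_ideal G. form G x a b = form G x b a) \<and>
     (\<forall>a\<in>aug_ideal G. form G x a a \<ge> 0)"

definition seminorm :: "('a, 'b) monoid_scheme \<Rightarrow> (('a \<Rightarrow>\<^sub>0 real) \<Rightarrow> real) \<Rightarrow> ('a \<Rightarrow>\<^sub>0 real) \<Rightarrow> real" where
  "seminorm G x a = sqrt (form G x a a)"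

definition null_space :: "('a, 'b) monoid_scheme \<Rightarrow> (('a \<Rightarrow>\<^sub>0 real) \<Rightarrow> real) \<Rightarrow> ('a \<Rightarrow>\<^sub>0 real) set" where
  "null_space G x = {a \<in> aug_ideal G. seminorm G x a = 0}"

definition aug_group :: "('a, 'b) monoid_scheme \<Rightarrow> ('a \<Rightarrow>\<^sub>0 real) monoid" where
  "aug_group G = \<lparr>carrier = aug_ideal G, mult = (+), one = 0\<rparr>"

text \<open>The class of an element of the augmentation ideal modulo \<open>null_space G x\<close>.\<close>

definition null_class :: "('a, 'b) monoid_scheme \<Rightarrow> (('a \<Rightarrow>\<^sub>0 real) \<Rightarrow> real) \<Rightarrow>
    ('a \<Rightarrow>\<^sub>0 real) \<Rightarrow> ('a \<Rightarrow>\<^sub>0 real) set" where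
  "null_class G x a = null_space G x #>\<^bsub>aug_group G\<^esub> a"

text \<open>
  The Hilbert space completion of the quotient by \<open>null_space G x\<close> is realised as the space of
  Cauchy sequences in the seminormed space \<open>aug_ideal G\<close> modulo the sequences of seminorm tending
  to \<open>0\<close>; passing to the quotient and completing it are done in a single step. Harmonicity only
  refers to addition in this space, so only the underlying (additive) abelian group is given, as
  a quotient in the multiplicatively written \<open>monoid\<close> record. The sum in the Hilbert space is
  therefore \<open>finprod\<close>, and its zero vector is \<open>\<one>\<close>.
\<close>

definition cauchy_seqs :: "('a, 'b) monoid_scheme \<Rightarrow> (('a \<Rightarrow>\<^sub>0 real) \<Rightarrow> real) \<Rightarrow>
    (nat \<Rightarrow> ('a \<Rightarrow>\<^sub>0 real)) set" where
  "cauchy_seqs G x = {u. (\<forall>n. u n \<in> aug_ideal G) \<and>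
     (\<forall>e>0. \<exists>N. \<forall>m\<ge>N. \<forall>n\<ge>N. seminorm G x (u m - u n) < e)}"

definition null_seqs :: "('a, 'b) monoid_scheme \<Rightarrow> (('a \<Rightarrow>\<^sub>0 real) \<Rightarrow> real) \<Rightarrow>
    (nat \<Rightarrow> ('a \<Rightarrow>\<^sub>0 real)) set" where
  "null_seqs G x = {u. (\<forall>n. u n \<in> aug_ideal G) \<and> (\<lambda>n. seminorm G x (u n)) \<longlonglongrightarrow> 0}"

definition cauchy_group :: "('a, 'b) monoid_scheme \<Rightarrow> (('a \<Rightarrow>\<^sub>0 real) \<Rightarrow> real) \<Rightarrow>
    (nat \<Rightarrow> ('a \<Rightarrow>\<^sub>0 real)) monoid" where
  "cauchy_group G x = \<lparr>carrier = cauchy_seqs G x, mult = (\<lambda>u v n. u n + v n), one = (\<lambda>n. 0)\<rparr>"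

definition hilbert :: "('a, 'b) monoid_scheme \<Rightarrow> (('a \<Rightarrow>\<^sub>0 real) \<Rightarrow> real) \<Rightarrow>
    (nat \<Rightarrow> ('a \<Rightarrow>\<^sub>0 real)) set monoid" where
  "hilbert G x = cauchy_group G x Mod null_seqs G x"

definition hilbert_class :: "('a, 'b) monoid_scheme \<Rightarrow> (('a \<Rightarrow>\<^sub>0 real) \<Rightarrow> real) \<Rightarrow>
    ('a \<Rightarrow>\<^sub>0 real) \<Rightarrow> (nat \<Rightarrow> ('a \<Rightarrow>\<^sub>0 real)) set" where
  "hilbert_class G x a = null_seqs G x #>\<^bsub>cauchy_group G x\<^esub> (\<lambda>n. a)"

definition cocycle :: "('a, 'b) monoid_scheme \<Rightarrow> (('a \<Rightarrow>\<^sub>0 real) \<Rightarrow> real) \<Rightarrow>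
    'a \<Rightarrow> (nat \<Rightarrow> ('a \<Rightarrow>\<^sub>0 real)) set" where
  "cocycle G x g = hilbert_class G x (\<delta> \<one>\<^bsub>G\<^esub> - \<delta> g)"

definition harmonic :: "('a, 'b) monoid_scheme \<Rightarrow> 'a set \<Rightarrow> (('a \<Rightarrow>\<^sub>0 real) \<Rightarrow> real) \<Rightarrow> bool" where
  "harmonic G S x \<longleftrightarrow> finprod (hilbert G x) (cocycle G x) S = \<one>\<^bsub>hilbert G x\<^esub>"

definition set_normalizer :: "('a, 'b) monoid_scheme \<Rightarrow> 'a set \<Rightarrow> 'a set" where
  "set_normalizer G S = {h \<in> carrier G. h <#\<^bsub>G\<^esub> S #>\<^bsub>G\<^esub> inv\<^bsub>G\<^esub> h = S}"

end

theory Submission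
  imports Defs
begin

text \<open>
  Write \<open>w g = g - g h\<close>, so that \<open>w \<one> = \<one> - h\<close> and \<open>w g\<close> is the left translate of \<open>w \<one>\<close> by \<open>g\<close>. The
  first claim says that \<open>w \<one>\<close> is fixed by \<open>G\<close> up to null vectors. The idea is to exhibit \<open>w \<one>\<close> as
  the average of the vectors \<open>w s\<close> with \<open>s \<in> S\<close>: they all have the same norm as \<open>w \<one>\<close>, because the
  form is left invariant, and in a Hilbert space an average of vectors of equal norm has that norm
  only if the vectors coincide.

  The average is computed as follows. Since \<open>h S = S h\<close>, the sum of the \<open>s h\<close> over \<open>S\<close> equals the
  sum of the \<open>h s\<close>, hence, with \<open>\<Delta> = \<Sum>s\<in>S. (\<one> - s)\<close>,
  \<open>\<Sum>s\<in>S. w s = \<Sum>s\<in>S. (s - h s) = |S| w \<one> - \<Delta> + h \<Delta>\<close>.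
  Harmonicity means that \<open>\<Delta>\<close> is a null vector, and by invariance so is \<open>h \<Delta>\<close>. This is
  \<open>normalizer_generator_fixes\<close>; the elements of \<open>G\<close> that fix \<open>w \<one>\<close> modulo null vectors are closed
  under products and inverses, so generators suffice (\<open>fixes_on_generated_subgroup\<close>).

  Right multiplication by \<open>h\<close> is thus a translation by \<open>h - \<one>\<close>, and its \<open>n\<close>-th power is the translation
  by \<open>n (h - \<one>)\<close>. If \<open>h\<close> has finite order, this translation is trivial for some \<open>n > 0\<close>, so \<open>h - \<one>\<close>
  is a null vector (\<open>torsion_null\<close>), and then \<open>\<one> - g h\<close> and \<open>\<one> - g\<close> differ by a null vector.
\<close>

section \<open>The group ring and its augmentation ideal\<close>

lemma lookup_scale: "Poly_Mapping.lookup (r *\<^sub>0 a) k = r * Poly_Mapping.lookup a k"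
  by (simp add: Poly_Mapping.map.rep_eq when_def)

lemma scale_single: "r *\<^sub>0 Poly_Mapping.single k v = Poly_Mapping.single k (r * v)"
  by (rule poly_mapping_eqI) (simp add: lookup_scale lookup_single when_def)

lemma keys_scale: "r \<noteq> 0 \<Longrightarrow> Poly_Mapping.keys (r *\<^sub>0 a) = Poly_Mapping.keys a"
  by (auto simp: in_keys_iff lookup_scale)

lemma scale_zero: "0 *\<^sub>0 a = 0"
  by (rule poly_mapping_eqI) (simp add: lookup_scale)

lemma uminus_eq_scale: "- a = (- 1) *\<^sub>0 a"
  by (rule poly_mapping_eqI) (simp add: lookup_scale)

lemma scale_sum: "r *\<^sub>0 (sum f A) = (\<Sum>i\<in>A. r *\<^sub>0 f i)"
  by (rule poly_mapping_eqI) (simp add: lookup_scale lookup_sum sum_distrib_left)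

lemma keys_sum_subset:
  "Poly_Mapping.keys (sum f A) \<subseteq> (\<Union>i\<in>A. Poly_Mapping.keys (f i))"
proof (induction A rule: infinite_finite_induct)
  case (insert i A)
  then show ?case using keys_add[of "f i" "sum f A"] by auto
qed simp_all

definition augmentation :: "('a \<Rightarrow>\<^sub>0 real) \<Rightarrow> real" where
  "augmentation a = (\<Sum>g\<in>Poly_Mapping.keys a. Poly_Mapping.lookup a g)"

lemma augmentation_add: "augmentation (a + b) = augmentation a + augmentation b"
  unfolding augmentation_def by (rule setsum_keys_plus_distrib) auto

lemma augmentation_single: "augmentation (Poly_Mapping.single g v) = v"
  by (simp add: augmentation_def)

lemma augmentation_zero: "augmentation 0 = 0"
  by (simp add: augmentation_def)

lemma augmentation_sum: "augmentation (sum f A) = (\<Sum>i\<in>A. augmentation (f i))"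
  by (induction A rule: infinite_finite_induct) (simp_all add: augmentation_zero augmentation_add)

lemma augmentation_scale: "augmentation (r *\<^sub>0 a) = r * augmentation a"
  by (cases "r = 0")
     (simp_all add: scale_zero augmentation_def keys_scale lookup_scale sum_distrib_left)

lemma mem_aug_ideal_iff:
  "a \<in> aug_ideal G \<longleftrightarrow> Poly_Mapping.keys a \<subseteq> carrier G \<and> augmentation a = 0"
  by (simp add: aug_ideal_def augmentation_def)

lemma zero_mem_aug_ideal [simp]: "0 \<in> aug_ideal G"
  by (simp add: aug_ideal_def)

lemma add_mem_aug_ideal [simp]:
  "a \<in> aug_ideal G \<Longrightarrow> b \<in> aug_ideal G \<Longrightarrow> a + b \<in> aug_ideal G"
  using keys_add[of a b] by (auto simp: mem_aug_ideal_iff augmentation_add)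

lemma scale_mem_aug_ideal [simp]: "a \<in> aug_ideal G \<Longrightarrow> r *\<^sub>0 a \<in> aug_ideal G"
  by (cases "r = 0") (auto simp: scale_zero augmentation_zero mem_aug_ideal_iff augmentation_scale keys_scale)

lemma uminus_mem_aug_ideal [simp]: "a \<in> aug_ideal G \<Longrightarrow> - a \<in> aug_ideal G"
  unfolding uminus_eq_scale by (rule scale_mem_aug_ideal)

lemma diff_mem_aug_ideal [simp]:
  "a \<in> aug_ideal G \<Longrightarrow> b \<in> aug_ideal G \<Longrightarrow> a - b \<in> aug_ideal G"
  using add_mem_aug_ideal[of a G "- b"] by simp

lemma sum_mem_aug_ideal:
  "(\<And>i. i \<in> A \<Longrightarrow> f i \<in> aug_ideal G) \<Longrightarrow> sum f A \<in> aug_ideal G"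
  by (induction A rule: infinite_finite_induct) auto

lemma group_elem_diff_mem_aug_ideal [simp]:
  assumes "p \<in> carrier G" "q \<in> carrier G"
  shows "\<delta> p - \<delta> q \<in> aug_ideal G"
proof -
  have "Poly_Mapping.keys (\<delta> p - \<delta> q :: 'a \<Rightarrow>\<^sub>0 real) \<subseteq> carrier G"
    using assms by (auto simp: in_keys_iff lookup_minus lookup_single when_def split: if_splits)
  moreover have "augmentation (\<delta> p - \<delta> q + \<delta> q) = augmentation (\<delta> p - \<delta> q) + augmentation (\<delta> q)"
    by (rule augmentation_add)
  ultimately show ?thesis by (simp add: mem_aug_ideal_iff augmentation_single)
qed

section \<open>Bilinearity of the twisted product\<close>

text \<open>
  Additivity holds on the whole group ring, which allows \<open>Phi\<close> of a difference of group elements to be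
  expanded even though the single group elements lie outside the augmentation ideal.
\<close>

lemma Phi_add_left: "Phi G (a + b) c = Phi G a c + Phi G b c"
  unfolding Phi_def scale_single
  by (rule setsum_keys_plus_distrib) (simp_all add: distrib_right single_add sum.distrib)

lemma Phi_add_right: "Phi G c (a + b) = Phi G c a + Phi G c b"
proof -
  have "(\<Sum>h\<in>Poly_Mapping.keys (a + b). (v * Poly_Mapping.lookup (a + b) h) *\<^sub>0 \<delta> (f h)) =
    (\<Sum>h\<in>Poly_Mapping.keys a. (v * Poly_Mapping.lookup a h) *\<^sub>0 \<delta> (f h)) +
    (\<Sum>h\<in>Poly_Mapping.keys b. (v * Poly_Mapping.lookup b h) *\<^sub>0 \<delta> (f h))"
    for v :: real and f :: "'a \<Rightarrow> 'a"
    unfolding scale_single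
    by (rule setsum_keys_plus_distrib) (simp_all add: distrib_left single_add)
  then show ?thesis
    by (simp add: Phi_def sum.distrib)
qed

lemma Phi_scale_left: "Phi G (r *\<^sub>0 a) c = r *\<^sub>0 Phi G a c"
  by (cases "r = 0")
     (simp_all add: scale_zero Phi_def keys_scale scale_sum lookup_scale scale_single mult.assoc)

lemma Phi_diff_left: "Phi G (a - b) c = Phi G a c - Phi G b c"
  using Phi_add_left[of G "a - b" b c] by simp

lemma Phi_diff_right: "Phi G c (a - b) = Phi G c a - Phi G c b"
  using Phi_add_right[of G c "a - b" b] by simp

lemma Phi_group_elem: "Phi G (\<delta> p) (\<delta> q) = \<delta> (inv\<^bsub>G\<^esub> p \<otimes>\<^bsub>G\<^esub> q)"
  by (simp add: Phi_def scale_single)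

lemma augmentation_Phi: "augmentation (Phi G a b) = augmentation a * augmentation b"
  by (simp add: Phi_def augmentation_sum scale_single augmentation_single)
     (simp add: augmentation_def sum_product)

lemma (in group) Phi_mem_aug_ideal [simp]:
  assumes "a \<in> aug_ideal G" "b \<in> aug_ideal G"
  shows "Phi G a b \<in> aug_ideal G"
proof -
  have "Poly_Mapping.keys (Phi G a b) \<subseteq>
    (\<Union>g\<in>Poly_Mapping.keys a. \<Union>h\<in>Poly_Mapping.keys b. {inv g \<otimes> h})"
    unfolding Phi_def scale_single
    by (intro order_trans[OF keys_sum_subset] UN_mono order_refl) auto
  also have "\<dots> \<subseteq> carrier G"
    using assms by (auto simp: aug_ideal_def)
  finally show ?thesis
    using assms by (simp add: mem_aug_ideal_iff augmentation_Phi)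
qed

section \<open>The positive semidefinite form of a functional\<close>

locale psd_functional_group = group G for G (structure) +
  fixes x :: "('a \<Rightarrow>\<^sub>0 real) \<Rightarrow> real"
  assumes psd: "psd_functional G x"
begin

abbreviation aug (\<open>I\<close>) where "I \<equiv> aug_ideal G"
abbreviation inner (\<open>\<langle>_, _\<rangle>\<close>) where "\<langle>a, b\<rangle> \<equiv> form G x a b"

lemma functional_add: "a \<in> I \<Longrightarrow> b \<in> I \<Longrightarrow> x (a + b) = x a + x b"
  using psd by (simp add: psd_functional_def aug_functional_def)

lemma functional_scale: "a \<in> I \<Longrightarrow> x (r *\<^sub>0 a) = r * x a"
  using psd by (simp add: psd_functional_def aug_functional_def)

lemma form_sym: "a \<in> I \<Longrightarrow> b \<in> I \<Longrightarrow> \<langle>a, b\<rangle> = \<langle>b, a\<rangle>"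
  using psd by (simp add: psd_functional_def)

lemma form_nonneg: "a \<in> I \<Longrightarrow> \<langle>a, a\<rangle> \<ge> 0"
  using psd by (simp add: psd_functional_def)

lemma form_add_left:
  "a \<in> I \<Longrightarrow> b \<in> I \<Longrightarrow> c \<in> I \<Longrightarrow> \<langle>a + b, c\<rangle> = \<langle>a, c\<rangle> + \<langle>b, c\<rangle>"
  by (simp add: form_def Phi_add_left functional_add)

lemma form_add_right:
  "a \<in> I \<Longrightarrow> b \<in> I \<Longrightarrow> c \<in> I \<Longrightarrow> \<langle>c, a + b\<rangle> = \<langle>c, a\<rangle> + \<langle>c, b\<rangle>"
  by (simp add: form_def Phi_add_right functional_add)

lemma form_diff_left:
  "a \<in> I \<Longrightarrow> b \<in> I \<Longrightarrow> c \<in> I \<Longrightarrow> \<langle>a - b, c\<rangle> = \<langle>a, c\<rangle> - \<langle>b, c\<rangle>"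
  using form_add_left[of "a - b" b c] by simp

lemma form_diff_right:
  "a \<in> I \<Longrightarrow> b \<in> I \<Longrightarrow> c \<in> I \<Longrightarrow> \<langle>c, a - b\<rangle> = \<langle>c, a\<rangle> - \<langle>c, b\<rangle>"
  using form_add_right[of "a - b" b c] by simp

lemma form_scale_left: "a \<in> I \<Longrightarrow> c \<in> I \<Longrightarrow> \<langle>r *\<^sub>0 a, c\<rangle> = r * \<langle>a, c\<rangle>"
  by (simp add: form_def Phi_scale_left functional_scale)

lemma form_zero_left: "c \<in> I \<Longrightarrow> \<langle>0, c\<rangle> = 0"
  using form_diff_left[of 0 0 c] by simp

lemma form_sum_left:
  "(\<And>i. i \<in> A \<Longrightarrow> f i \<in> I) \<Longrightarrow> c \<in> I \<Longrightarrow> \<langle>sum f A, c\<rangle> = (\<Sum>i\<in>A. \<langle>f i, c\<rangle>)"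
  by (induction A rule: infinite_finite_induct)
     (simp_all add: form_zero_left form_add_left sum_mem_aug_ideal)

lemma form_add_self:
  assumes "a \<in> I" "b \<in> I"
  shows "\<langle>a + b, a + b\<rangle> = \<langle>a, a\<rangle> + 2 * \<langle>a, b\<rangle> + \<langle>b, b\<rangle>"
  using assms form_sym[of a b] by (simp add: form_add_left form_add_right)

lemma form_diff_self:
  assumes "a \<in> I" "b \<in> I"
  shows "\<langle>a - b, a - b\<rangle> = \<langle>a, a\<rangle> - 2 * \<langle>a, b\<rangle> + \<langle>b, b\<rangle>"
  using assms form_sym[of a b] by (simp add: form_diff_left form_diff_right)

text \<open>
  This is the degenerate case of the Cauchy--Schwarz inequality: \<open>t \<mapsto> \<langle>t a + b, t a + b\<rangle>\<close> is affine
  and bounded below, hence constant.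
\<close>

lemma form_null_left:
  assumes "a \<in> I" "b \<in> I" "\<langle>a, a\<rangle> = 0"
  shows "\<langle>a, b\<rangle> = 0"
proof (rule ccontr)
  assume nz: "\<langle>a, b\<rangle> \<noteq> 0"
  have ge: "0 \<le> 2 * t * \<langle>a, b\<rangle> + \<langle>b, b\<rangle>" for t
  proof -
    have "\<langle>a, t *\<^sub>0 a\<rangle> = 0"
      using assms form_sym[of a "t *\<^sub>0 a"] by (simp add: form_scale_left)
    then show ?thesis
      using assms form_nonneg[of "t *\<^sub>0 a + b"] by (simp add: form_add_self form_scale_left)
  qed
  \<comment> \<open>With this \<open>t\<close> the right side of \<open>ge\<close> is \<open>-1\<close>.\<close>
  show False
    using ge[of "- (\<langle>b, b\<rangle> + 1) / (2 * \<langle>a, b\<rangle>)"] nz by (simp add: field_simps)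
qed

lemma mem_null_space_iff: "a \<in> null_space G x \<longleftrightarrow> a \<in> I \<and> \<langle>a, a\<rangle> = 0"
  by (auto simp: null_space_def seminorm_def)

lemma seminorm_nonneg: "a \<in> I \<Longrightarrow> 0 \<le> seminorm G x a"
  by (simp add: seminorm_def form_nonneg)

lemma seminorm_uminus: "a \<in> I \<Longrightarrow> seminorm G x (- a) = seminorm G x a"
  using form_diff_self[of 0 a] form_zero_left[of a] form_zero_left[of 0]
  by (simp add: seminorm_def)

text \<open>
  A triangle inequality up to the factor 2 suffices for all topological purposes, and it follows
  from \<open>\<langle>a - b, a - b\<rangle> \<ge> 0\<close> alone.
\<close>

lemma seminorm_add_le:
  assumes "a \<in> I" "b \<in> I"
  shows "seminorm G x (a + b) \<le> 2 * (seminorm G x a + seminorm G x b)"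
proof (rule power2_le_imp_le)
  have "\<langle>a + b, a + b\<rangle> \<le> 2 * (\<langle>a, a\<rangle> + \<langle>b, b\<rangle>)"
    using form_nonneg[of "a - b"] assms by (simp add: form_add_self form_diff_self)
  then have "(seminorm G x (a + b))\<^sup>2 \<le> 2 * ((seminorm G x a)\<^sup>2 + (seminorm G x b)\<^sup>2)"
    using assms by (simp add: seminorm_def form_nonneg)
  also have "\<dots> \<le> (2 * (seminorm G x a + seminorm G x b))\<^sup>2"
    using seminorm_nonneg[OF assms(1)] seminorm_nonneg[OF assms(2)]
    by (simp add: power2_eq_square algebra_simps)
  finally show "(seminorm G x (a + b))\<^sup>2 \<le> (2 * (seminorm G x a + seminorm G x b))\<^sup>2" .
  show "0 \<le> 2 * (seminorm G x a + seminorm G x b)"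
    using assms by (simp add: seminorm_nonneg)
qed

lemma null_space_add:
  assumes "a \<in> null_space G x" "b \<in> null_space G x"
  shows "a + b \<in> null_space G x"
  using assms form_null_left[of a b] by (simp add: mem_null_space_iff form_add_self)

lemma null_space_uminus: "a \<in> null_space G x \<Longrightarrow> - a \<in> null_space G x"
  by (simp add: null_space_def seminorm_uminus)

lemma null_class_eqI:
  assumes "a - b \<in> null_space G x"
  shows "null_class G x a = null_class G x b"
proof -
  have "\<exists>n'\<in>null_space G x. n + a = n' + b" if "n \<in> null_space G x" for n
    using null_space_add[OF that assms] by (intro bexI[of _ "n + (a - b)"]) auto
  moreover have "\<exists>n'\<in>null_space G x. n + b = n' + a" if "n \<in> null_space G x" for n
    using null_space_add[OF that null_space_uminus[OF assms]]
    by (intro bexI[of _ "n + - (a - b)"]) auto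
  ultimately show ?thesis
    by (force simp: null_class_def r_coset_def aug_group_def)
qed

section \<open>Vanishing of a finite sum in the completion\<close>

lemma comm_group_cauchy_group: "comm_group (cauchy_group G x)"
proof (rule comm_groupI)
  fix u v assume "u \<in> carrier (cauchy_group G x)" "v \<in> carrier (cauchy_group G x)"
  then have u: "u \<in> cauchy_seqs G x" and v: "v \<in> cauchy_seqs G x"
    by (simp_all add: cauchy_group_def)
  have "\<exists>N. \<forall>m\<ge>N. \<forall>n\<ge>N. seminorm G x ((u m + v m) - (u n + v n)) < e" if e: "e > 0" for e
  proof -
    have e': "e / 4 > 0" using e by simp
    obtain M where M: "\<And>m n. m \<ge> M \<Longrightarrow> n \<ge> M \<Longrightarrow> seminorm G x (u m - u n) < e / 4"
      using u e' unfolding cauchy_seqs_def by blast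
    obtain N where N: "\<And>m n. m \<ge> N \<Longrightarrow> n \<ge> N \<Longrightarrow> seminorm G x (v m - v n) < e / 4"
      using v e' unfolding cauchy_seqs_def by blast
    have "seminorm G x ((u m + v m) - (u n + v n)) < e"
      if "m \<ge> max M N" "n \<ge> max M N" for m n
    proof -
      have "seminorm G x ((u m - u n) + (v m - v n))
          \<le> 2 * (seminorm G x (u m - u n) + seminorm G x (v m - v n))"
        using u v by (intro seminorm_add_le) (simp_all add: cauchy_seqs_def)
      also have "\<dots> < e"
        using M[of m n] N[of m n] that by simp
      finally show ?thesis by (simp add: algebra_simps)
    qed
    then show ?thesis by blast
  qed
  then show "u \<otimes>\<^bsub>cauchy_group G x\<^esub> v \<in> carrier (cauchy_group G x)"
    using u v by (simp add: cauchy_group_def cauchy_seqs_def)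
next
  fix u assume "u \<in> carrier (cauchy_group G x)"
  then have u: "u \<in> cauchy_seqs G x" by (simp add: cauchy_group_def)
  have "seminorm G x (- u m - - u n) = seminorm G x (u m - u n)" for m n
    using seminorm_uminus[of "u m - u n"] u by (simp add: cauchy_seqs_def)
  then have "(\<lambda>n. - u n) \<in> cauchy_seqs G x"
    using u by (simp add: cauchy_seqs_def)
  then show "\<exists>v\<in>carrier (cauchy_group G x).
      v \<otimes>\<^bsub>cauchy_group G x\<^esub> u = \<one>\<^bsub>cauchy_group G x\<^esub>"
    by (intro bexI[of _ "\<lambda>n. - u n"]) (simp_all add: cauchy_group_def)
qed (auto simp: cauchy_group_def cauchy_seqs_def seminorm_def form_zero_left add.assoc add.commute)

lemma null_seqs_subset_cauchy_seqs: "null_seqs G x \<subseteq> cauchy_seqs G x"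
proof
  fix u assume u: "u \<in> null_seqs G x"
  have "\<exists>N. \<forall>m\<ge>N. \<forall>n\<ge>N. seminorm G x (u m - u n) < e" if e: "e > 0" for e
  proof -
    have "\<forall>\<^sub>F n in sequentially. seminorm G x (u n) < e / 4"
      using u e by (intro order_tendstoD(2)[where y = 0]) (simp_all add: null_seqs_def)
    then obtain N where N: "\<And>n. n \<ge> N \<Longrightarrow> seminorm G x (u n) < e / 4"
      by (auto simp: eventually_sequentially)
    have "seminorm G x (u m - u n) < e" if "m \<ge> N" "n \<ge> N" for m n
      using seminorm_add_le[of "u m" "- u n"] seminorm_uminus[of "u n"] N[of m] N[of n] that u
      by (simp add: null_seqs_def)
    then show ?thesis by blast
  qed
  then show "u \<in> cauchy_seqs G x"
    using u by (simp add: null_seqs_def cauchy_seqs_def)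
qed

lemma subgroup_null_seqs: "subgroup (null_seqs G x) (cauchy_group G x)"
proof (rule group.subgroupI)
  show grp: "group (cauchy_group G x)"
    using comm_group_cauchy_group by (rule comm_group.axioms)
  show "null_seqs G x \<subseteq> carrier (cauchy_group G x)"
    using null_seqs_subset_cauchy_seqs by (simp add: cauchy_group_def)
  have "(\<lambda>n. 0) \<in> null_seqs G x"
    by (simp add: null_seqs_def seminorm_def form_zero_left)
  then show "null_seqs G x \<noteq> {}" by blast
next
  fix u assume u: "u \<in> null_seqs G x"
  have neg: "(\<lambda>n. - u n) \<in> null_seqs G x"
    using u by (simp add: null_seqs_def seminorm_uminus)
  have "inv\<^bsub>cauchy_group G x\<^esub> u = (\<lambda>n. - u n)"
    using u neg null_seqs_subset_cauchy_seqs comm_group_cauchy_group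
    by (intro group.inv_equality comm_group.axioms(2)) (auto simp: cauchy_group_def)
  with neg show "inv\<^bsub>cauchy_group G x\<^esub> u \<in> null_seqs G x" by simp
next
  fix u v assume u: "u \<in> null_seqs G x" and v: "v \<in> null_seqs G x"
  have "(\<lambda>n. seminorm G x (u n + v n)) \<longlonglongrightarrow> 0"
  proof (rule tendsto_sandwich)
    show "\<forall>\<^sub>F n in sequentially. 0 \<le> seminorm G x (u n + v n)"
      using u v by (simp add: null_seqs_def seminorm_nonneg)
    show "\<forall>\<^sub>F n in sequentially. seminorm G x (u n + v n)
        \<le> 2 * (seminorm G x (u n) + seminorm G x (v n))"
      using u v
      by (intro always_eventually allI seminorm_add_le) (simp_all add: null_seqs_def)
    have "(\<lambda>n. 2 * (seminorm G x (u n) + seminorm G x (v n))) \<longlonglongrightarrow> 2 * (0 + 0)"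
      using u v by (intro tendsto_intros) (simp_all add: null_seqs_def)
    then show "(\<lambda>n. 2 * (seminorm G x (u n) + seminorm G x (v n))) \<longlonglongrightarrow> 0" by simp
  qed simp
  then show "u \<otimes>\<^bsub>cauchy_group G x\<^esub> v \<in> null_seqs G x"
    using u v by (simp add: null_seqs_def cauchy_group_def)
qed

lemma normal_null_seqs: "null_seqs G x \<lhd> cauchy_group G x"
  using comm_group.normal_iff_subgroup[OF comm_group_cauchy_group] subgroup_null_seqs by blast

lemma const_mem_cauchy_seqs: "a \<in> I \<Longrightarrow> (\<lambda>n. a) \<in> cauchy_seqs G x"
  by (simp add: cauchy_seqs_def seminorm_def form_zero_left)

lemma hilbert_class_mem: "a \<in> I \<Longrightarrow> hilbert_class G x a \<in> carrier (hilbert G x)"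
  by (auto simp: hilbert_class_def hilbert_def carrier_FactGroup cauchy_group_def
      const_mem_cauchy_seqs)

lemma hilbert_class_add:
  assumes "a \<in> I" "b \<in> I"
  shows "hilbert_class G x (a + b) = hilbert_class G x a \<otimes>\<^bsub>hilbert G x\<^esub> hilbert_class G x b"
  using normal.rcos_sum[OF normal_null_seqs, of "\<lambda>n. a" "\<lambda>n. b"] assms
  by (simp add: hilbert_class_def hilbert_def cauchy_group_def const_mem_cauchy_seqs)

lemma hilbert_class_zero: "hilbert_class G x 0 = \<one>\<^bsub>hilbert G x\<^esub>"
  by (simp add: hilbert_class_def hilbert_def r_coset_def cauchy_group_def)

lemma hilbert_class_sum:
  assumes "finite A" "\<And>i. i \<in> A \<Longrightarrow> f i \<in> I"
  shows "hilbert_class G x (sum f A) = finprod (hilbert G x) (\<lambda>i. hilbert_class G x (f i)) A"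
proof -
  interpret Hilbert: comm_group "hilbert G x"
    unfolding hilbert_def
    by (rule comm_group.abelian_FactGroup[OF comm_group_cauchy_group subgroup_null_seqs])
  show ?thesis
    using assms
    by (induction A rule: finite_induct)
       (simp_all add: hilbert_class_zero hilbert_class_add hilbert_class_mem sum_mem_aug_ideal Pi_def)
qed

text \<open>The augmentation ideal modulo null vectors embeds into the completion.\<close>

lemma hilbert_class_eq_one_iff:
  assumes "a \<in> I"
  shows "hilbert_class G x a = \<one>\<^bsub>hilbert G x\<^esub> \<longleftrightarrow> a \<in> null_space G x"
proof -
  interpret Cauchy: comm_group "cauchy_group G x" by (rule comm_group_cauchy_group)
  have "hilbert_class G x a = \<one>\<^bsub>hilbert G x\<^esub> \<longleftrightarrow> (\<lambda>n. a) \<in> null_seqs G x"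
    using Cauchy.coset_join1[OF _ _ subgroup_null_seqs, of "\<lambda>n. a"]
      Cauchy.coset_join2[OF _ subgroup_null_seqs, of "\<lambda>n. a"] const_mem_cauchy_seqs[OF assms]
    by (auto simp: hilbert_class_def hilbert_def cauchy_group_def)
  then show ?thesis
    using assms by (simp add: null_seqs_def null_space_def tendsto_const_iff)
qed

text \<open>
  The class of the Laplacian in the completion is the sum of the cocycle over \<open>S\<close>. With this lemma
  harmonicity becomes a statement about the augmentation ideal, and the completion can be forgotten.
\<close>

lemma harmonic_laplacian_null:
  assumes "finite S" "S \<subseteq> carrier G" "harmonic G S x"
  shows "(\<Sum>s\<in>S. \<delta> \<one> - \<delta> s) \<in> null_space G x"
proof -
  have mem: "\<delta> \<one> - \<delta> s \<in> I" if "s \<in> S" for s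
    using that assms by auto
  then have "hilbert_class G x (\<Sum>s\<in>S. \<delta> \<one> - \<delta> s) = \<one>\<^bsub>hilbert G x\<^esub>"
    using assms hilbert_class_sum[of S "\<lambda>s. \<delta> \<one> - \<delta> s"]
    by (simp add: harmonic_def cocycle_def[abs_def])
  then show ?thesis
    using mem by (simp add: hilbert_class_eq_one_iff sum_mem_aug_ideal)
qed

section \<open>Left invariance\<close>

lemma inv_mult_translate:
  assumes "g \<in> carrier G" "p \<in> carrier G" "q \<in> carrier G"
  shows "inv (g \<otimes> p) \<otimes> (g \<otimes> q) = inv p \<otimes> q"
  using assms by (simp add: inv_mult_group m_assoc inv_solve_left')

lemma form_translate:
  assumes "g \<in> carrier G" "p \<in> carrier G" "q \<in> carrier G" "r \<in> carrier G" "s \<in> carrier G"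
  shows "\<langle>\<delta> (g \<otimes> p) - \<delta> (g \<otimes> q), \<delta> (g \<otimes> r) - \<delta> (g \<otimes> s)\<rangle> = \<langle>\<delta> p - \<delta> q, \<delta> r - \<delta> s\<rangle>"
  using assms
  by (simp add: form_def Phi_diff_left Phi_diff_right Phi_group_elem inv_mult_translate)

text \<open>
  The square of \<open>a - b\<close> expands into products of differences of two group elements, and each of these
  products is invariant by \<open>form_translate\<close>.
\<close>

lemma null_space_translate:
  assumes "g \<in> carrier G" "p \<in> carrier G" "q \<in> carrier G" "r \<in> carrier G" "s \<in> carrier G"
    and "(\<delta> p - \<delta> q) - (\<delta> r - \<delta> s) \<in> null_space G x"
  shows "(\<delta> (g \<otimes> p) - \<delta> (g \<otimes> q)) - (\<delta> (g \<otimes> r) - \<delta> (g \<otimes> s)) \<in> null_space G x"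
  using assms by (simp add: mem_null_space_iff form_diff_self form_translate)

section \<open>Right translation by elements normalizing the generating set\<close>

text \<open>Conjugation by \<open>h\<close> permutes \<open>S\<close>, and it turns \<open>s h\<close> into \<open>h s\<close>.\<close>

lemma sum_set_normalizer:
  assumes "h \<in> set_normalizer G S" "S \<subseteq> carrier G"
  shows "(\<Sum>s\<in>S. f (s \<otimes> h)) = (\<Sum>s\<in>S. f (h \<otimes> s))"
proof -
  have h: "h \<in> carrier G" and eq: "h <# S #> inv h = S"
    using assms by (auto simp: set_normalizer_def)
  have inj: "inj_on (\<lambda>s. h \<otimes> s \<otimes> inv h) S"
    using assms(2) h by (intro inj_onI) (auto simp: subset_iff)
  have img: "(\<lambda>s. h \<otimes> s \<otimes> inv h) ` S = S"
    using eq by (auto simp: l_coset_def r_coset_def)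
  have "(\<Sum>s\<in>S. f (s \<otimes> h)) = (\<Sum>s\<in>(\<lambda>s. h \<otimes> s \<otimes> inv h) ` S. f (s \<otimes> h))"
    by (simp only: img)
  also have "\<dots> = (\<Sum>s\<in>S. f (h \<otimes> s \<otimes> inv h \<otimes> h))"
    by (simp add: sum.reindex[OF inj])
  also have "\<dots> = (\<Sum>s\<in>S. f (h \<otimes> s))"
    using assms(2) h by (intro sum.cong refl arg_cong[of _ _ f]) (auto simp: m_assoc subset_iff)
  finally show ?thesis .
qed

text \<open>
  This is the case of equality in the convexity argument, with \<open>w g = g - g h\<close>: if \<open>|w s|\<^sup>2 = |w \<one>|\<^sup>2\<close> for all \<open>s\<close> and the products \<open>\<langle>w s, w \<one>\<rangle>\<close> add up to \<open>|S| |w \<one>|\<^sup>2\<close>,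
  then the squares \<open>|w s - w \<one>|\<^sup>2\<close> add up to \<open>0\<close>.
\<close>

lemma normalizer_generator_fixes:
  assumes "finite S" "S \<subseteq> carrier G" "harmonic G S x" "h \<in> set_normalizer G S" "s \<in> S"
  shows "(\<delta> s - \<delta> (s \<otimes> h)) - (\<delta> \<one> - \<delta> h) \<in> null_space G x"
proof -
  define w where "w = (\<lambda>g. \<delta> g - \<delta> (g \<otimes> h) :: 'a \<Rightarrow>\<^sub>0 real)"
  have h: "h \<in> carrier G"
    using assms by (simp add: set_normalizer_def)
  have S: "s \<in> carrier G" if "s \<in> S" for s
    using that assms(2) by blast
  have w [simp]: "w g \<in> I" if "g \<in> carrier G" for g
    using that h by (simp add: w_def)
  have w_one: "w \<one> = \<delta> \<one> - \<delta> h"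
    using h by (simp add: w_def)
  have norm_w: "\<langle>w g, w g\<rangle> = \<langle>w \<one>, w \<one>\<rangle>" if "g \<in> carrier G" for g
    using form_translate[of g \<one> h \<one> h] that h by (simp add: w_def)
  define L where "L = (\<Sum>s\<in>S. \<delta> \<one> - \<delta> s :: 'a \<Rightarrow>\<^sub>0 real)"
  have L: "L \<in> I" "\<langle>L, L\<rangle> = 0"
    using harmonic_laplacian_null[OF assms(1-3)] by (simp_all add: L_def mem_null_space_iff)
  have lap: "(\<Sum>s\<in>S. \<langle>\<delta> \<one> - \<delta> s, a\<rangle>) = 0" if "a \<in> I" for a
    using form_null_left[OF L(1) that L(2)] form_sum_left[of S "\<lambda>s. \<delta> \<one> - \<delta> s" a] S that
    by (simp add: L_def)
  \<comment> \<open>In the sum of the \<open>w s\<close>, replacing each \<open>s h\<close> by \<open>h s\<close> leaves \<open>|S| (1 - h)\<close> up to a Laplacian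
    and a left translate by \<open>h\<close> of one.\<close>
  have "(\<Sum>s\<in>S. w s) = (\<Sum>s\<in>S. \<delta> s) - (\<Sum>s\<in>S. \<delta> (h \<otimes> s))"
    using sum_set_normalizer[OF assms(4,2), of \<delta>] by (simp add: w_def sum_subtractf)
  also have "\<dots> = (\<Sum>s\<in>S. w \<one> - (\<delta> \<one> - \<delta> s) + (\<delta> h - \<delta> (h \<otimes> s)))"
    by (simp add: w_one sum_subtractf sum.distrib)
  finally have "(\<Sum>s\<in>S. \<langle>w s, w \<one>\<rangle>) =
      \<langle>(\<Sum>s\<in>S. w \<one> - (\<delta> \<one> - \<delta> s) + (\<delta> h - \<delta> (h \<otimes> s))), w \<one>\<rangle>"
    using form_sum_left[of S w "w \<one>"] S by simp
  also have "\<dots> = (\<Sum>s\<in>S. \<langle>w \<one>, w \<one>\<rangle> - \<langle>\<delta> \<one> - \<delta> s, w \<one>\<rangle> + \<langle>\<delta> h - \<delta> (h \<otimes> s), w \<one>\<rangle>)"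
    using S h by (simp add: form_sum_left form_add_left form_diff_left)
  also have "\<dots> = (\<Sum>s\<in>S. \<langle>w \<one>, w \<one>\<rangle>) - (\<Sum>s\<in>S. \<langle>\<delta> \<one> - \<delta> s, w \<one>\<rangle>)
      + (\<Sum>s\<in>S. \<langle>\<delta> h - \<delta> (h \<otimes> s), w \<one>\<rangle>)"
    by (simp only: sum.distrib sum_subtractf)
  also have "(\<Sum>s\<in>S. \<langle>\<delta> h - \<delta> (h \<otimes> s), w \<one>\<rangle>) = (\<Sum>s\<in>S. \<langle>\<delta> \<one> - \<delta> s, \<delta> (inv h) - \<delta> \<one>\<rangle>)"
    using form_translate[of h \<one> _ "inv h" \<one>] S h by (intro sum.cong refl) (simp add: w_one)
  finally have mean: "(\<Sum>s\<in>S. \<langle>w s, w \<one>\<rangle>) = (\<Sum>s\<in>S. \<langle>w \<one>, w \<one>\<rangle>)"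
    using lap[of "w \<one>"] lap[of "\<delta> (inv h) - \<delta> \<one>"] h by simp
  have "(\<Sum>s\<in>S. \<langle>w s - w \<one>, w s - w \<one>\<rangle>) = (\<Sum>s\<in>S. 2 * \<langle>w \<one>, w \<one>\<rangle> - 2 * \<langle>w s, w \<one>\<rangle>)"
  proof (intro sum.cong refl)
    fix s assume "s \<in> S"
    then show "\<langle>w s - w \<one>, w s - w \<one>\<rangle> = 2 * \<langle>w \<one>, w \<one>\<rangle> - 2 * \<langle>w s, w \<one>\<rangle>"
      using S norm_w[of s] by (simp add: form_diff_self)
  qed
  also have "\<dots> = 0"
    using mean by (simp add: sum_subtractf flip: sum_distrib_left)
  finally have "\<forall>s\<in>S. \<langle>w s - w \<one>, w s - w \<one>\<rangle> = 0"
    using assms(1) S by (subst (asm) sum_nonneg_eq_0_iff) (auto intro!: form_nonneg)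
  then show ?thesis
    using assms(5) S by (simp add: mem_null_space_iff w_def h)
qed

lemma fixes_on_generated_subgroup:
  assumes "S \<subseteq> carrier G" "p \<in> carrier G" "q \<in> carrier G"
    and gen: "\<And>s. s \<in> S \<Longrightarrow> (\<delta> (s \<otimes> p) - \<delta> (s \<otimes> q)) - (\<delta> p - \<delta> q) \<in> null_space G x"
    and "g \<in> generate G S"
  shows "(\<delta> (g \<otimes> p) - \<delta> (g \<otimes> q)) - (\<delta> p - \<delta> q) \<in> null_space G x"
  using assms(5)
proof (induction rule: generate.induct)
  case one
  then show ?case using assms by (simp add: mem_null_space_iff form_zero_left)
next
  case (incl s)
  then show ?case by (rule gen)
next
  case (inv s)
  have s: "s \<in> carrier G" using inv assms by blast
  have "(\<delta> (inv s \<otimes> (s \<otimes> p)) - \<delta> (inv s \<otimes> (s \<otimes> q))) - (\<delta> (inv s \<otimes> p) - \<delta> (inv s \<otimes> q))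
      \<in> null_space G x"
    using assms s by (intro null_space_translate gen inv) simp_all
  then have "- ((\<delta> p - \<delta> q) - (\<delta> (inv s \<otimes> p) - \<delta> (inv s \<otimes> q))) \<in> null_space G x"
    using assms s by (intro null_space_uminus) (simp flip: m_assoc)
  then show ?case by simp
next
  case (eng k l)
  have kl: "k \<in> carrier G" "l \<in> carrier G"
    using eng assms(1) generate_in_carrier by blast+
  have "(\<delta> (k \<otimes> (l \<otimes> p)) - \<delta> (k \<otimes> (l \<otimes> q))) - (\<delta> (k \<otimes> p) - \<delta> (k \<otimes> q)) \<in> null_space G x"
    using assms kl by (intro null_space_translate eng) simp_all
  moreover have "a - c = (a - b) + (b - c)" for a b c :: "'a \<Rightarrow>\<^sub>0 real"
    by simp
  ultimately have "(\<delta> (k \<otimes> (l \<otimes> p)) - \<delta> (k \<otimes> (l \<otimes> q))) - (\<delta> p - \<delta> q) \<in> null_space G x"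
    using eng.IH(1) null_space_add by metis
  then show ?case
    using assms kl by (simp add: m_assoc)
qed

text \<open>
  The powers \<open>h\<^sup>k\<close> move away from \<open>\<one>\<close> at constant speed in the direction of \<open>v = h - \<one>\<close>: telescoping
  gives \<open>\<langle>h\<^sup>k - \<one>, v\<rangle> = k \<langle>v, v\<rangle>\<close>, and the left side vanishes for \<open>h\<^sup>k = \<one>\<close>.
\<close>

lemma torsion_null:
  fixes n :: nat
  assumes h: "h \<in> carrier G" and "n > 0" "h [^] n = \<one>"
    and trans: "\<And>g. g \<in> carrier G \<Longrightarrow> (\<delta> (g \<otimes> h) - \<delta> g) - (\<delta> h - \<delta> \<one>) \<in> null_space G x"
  shows "\<delta> h - \<delta> \<one> \<in> null_space G x"
proof -
  let ?v = "\<delta> h - \<delta> \<one> :: 'a \<Rightarrow>\<^sub>0 real"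
  have "\<langle>\<delta> (h [^] k) - \<delta> \<one>, ?v\<rangle> = real k * \<langle>?v, ?v\<rangle>" for k :: nat
  proof (induction k)
    case 0
    then show ?case using h by (simp add: form_zero_left)
  next
    case (Suc k)
    let ?u = "\<delta> (h [^] k \<otimes> h) - \<delta> (h [^] k) :: 'a \<Rightarrow>\<^sub>0 real"
    have "\<langle>?u - ?v, ?v\<rangle> = 0"
      using trans[of "h [^] k"] h form_null_left[of "?u - ?v" ?v] by (simp add: mem_null_space_iff)
    then have "\<langle>?u, ?v\<rangle> = \<langle>?v, ?v\<rangle>"
      using h by (simp add: form_diff_left)
    moreover have "\<langle>?u + (\<delta> (h [^] k) - \<delta> \<one>), ?v\<rangle> = \<langle>?u, ?v\<rangle> + \<langle>\<delta> (h [^] k) - \<delta> \<one>, ?v\<rangle>"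
      using h by (intro form_add_left) simp_all
    ultimately show ?case
      using Suc.IH by (simp add: algebra_simps)
  qed
  from this[of n] have "real n * \<langle>?v, ?v\<rangle> = 0"
    using assms h by (simp add: form_zero_left)
  then show ?thesis
    using \<open>n > 0\<close> h by (simp add: mem_null_space_iff)
qed

lemma seminorm_cong:
  assumes "a \<in> I" "b \<in> I" "a - b \<in> null_space G x"
  shows "seminorm G x a = seminorm G x b"
proof -
  have "\<langle>(a - b) + b, (a - b) + b\<rangle> = \<langle>b, b\<rangle>"
    using assms form_null_left[of "a - b" b]
    by (subst form_add_self) (simp_all add: mem_null_space_iff)
  then show ?thesis by (simp add: seminorm_def)
qed

end

theorem lemma4p2:
  fixes G :: "('a, 'b) monoid_scheme" (structure)
    and S :: "'a set" and x :: "('a \<Rightarrow>\<^sub>0 real) \<Rightarrow> real"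
  assumes "group G"
    and "finite S" and "S \<subseteq> carrier G" and "set_inv S = S" and "generate G S = carrier G"
    and "psd_functional G x" and "harmonic G S x"
    and "h \<in> set_normalizer G S"
  shows "(\<forall>g\<in>carrier G. null_class G x (\<delta> (g \<otimes> h) - \<delta> g) = null_class G x (\<delta> h - \<delta> \<one>)) \<and>
    ((\<exists>n::nat. n > 0 \<and> h [^] n = \<one>) \<longrightarrow>
      (\<forall>g\<in>carrier G. seminorm G x (\<delta> \<one> - \<delta> (g \<otimes> h)) = seminorm G x (\<delta> \<one> - \<delta> g)) \<and>
      seminorm G x (\<delta> \<one> - \<delta> h) = 0)"
proof -
  interpret group G by fact
  interpret psd_functional_group G x by unfold_locales fact
  have h: "h \<in> carrier G"
    using assms(8) by (simp add: set_normalizer_def)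
  have trans: "(\<delta> (g \<otimes> h) - \<delta> g) - (\<delta> h - \<delta> \<one>) \<in> null_space G x" if g: "g \<in> carrier G" for g
  proof -
    have "(\<delta> (g \<otimes> h) - \<delta> (g \<otimes> \<one>)) - (\<delta> h - \<delta> \<one>) \<in> null_space G x"
    proof (rule fixes_on_generated_subgroup)
      fix s assume s: "s \<in> S"
      have "- ((\<delta> s - \<delta> (s \<otimes> h)) - (\<delta> \<one> - \<delta> h)) \<in> null_space G x"
        by (intro null_space_uminus normalizer_generator_fixes) fact+
      then show "(\<delta> (s \<otimes> h) - \<delta> (s \<otimes> \<one>)) - (\<delta> h - \<delta> \<one>) \<in> null_space G x"
        using s assms(3) by (simp add: subset_iff algebra_simps)
    qed (use assms g h in simp_all)
    then show ?thesis using g by simp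
  qed
  show ?thesis
  proof (intro conjI impI ballI)
    fix g assume "g \<in> carrier G"
    then show "null_class G x (\<delta> (g \<otimes> h) - \<delta> g) = null_class G x (\<delta> h - \<delta> \<one>)"
      by (intro null_class_eqI trans)
  next
    assume "\<exists>n::nat. n > 0 \<and> h [^] n = \<one>"
    then have v: "\<delta> h - \<delta> \<one> \<in> null_space G x"
      using torsion_null[OF h _ _ trans] by blast
    have "- (\<delta> h - \<delta> \<one>) \<in> null_space G x"
      using v by (rule null_space_uminus)
    then show "seminorm G x (\<delta> \<one> - \<delta> h) = 0"
      by (simp add: null_space_def)
    fix g assume g: "g \<in> carrier G"
    have "- ((\<delta> (g \<otimes> h) - \<delta> g) - (\<delta> h - \<delta> \<one>) + (\<delta> h - \<delta> \<one>)) \<in> null_space G x"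
      using g by (intro null_space_uminus null_space_add trans v)
    then show "seminorm G x (\<delta> \<one> - \<delta> (g \<otimes> h)) = seminorm G x (\<delta> \<one> - \<delta> g)"
      using g h by (intro seminorm_cong) simp_all
  qed
qed

end
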